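(* Consider mappings $\Phi,\widehat{\Phi}:\Omega_\zeta\to\mathbb{H}(\mathbb{C})$ whose components $U_k:\Omega\to\mathbb{C}$ ($k=1,2,3,4$) in the decomposition with respect to the basis $\{e_1,e_2,e_3,e_4\}$ are $\mathbb{R}$-differentiable in $\Omega$. Then $\Phi$ is right-$G$-monogenic in $\Omega_\zeta$ if and only if it is right-$H$-monogenic in $\Omega_\zeta$, and $\widehat{\Phi}$ is left-$G$-monogenic in $\Omega_\zeta$ if and only if it is left-$H$-monogenic in $\Omega_\zeta$.
   Context: $\mathbb{H}(\mathbb{C})$ is the algebra of quaternions over $\mathbb{C}$ with basis $1,I,J,K$ ($I^2=J^2=K^2=-1$, $IJ=-JI=K$, $JK=-KJ=I$, $KI=-IK=J$). With $i$ the imaginary complex unit, another basis is $e_1=\frac12(1+iI)$, $e_2=\frac12(1-iI)$, $e_3=\frac12(iJ-K)$, $e_4=\frac12(iJ+K)$, with nonzero products $e_1e_1=e_1$, $e_1e_3=e_3$, $e_2e_2=e_2$, $e_2e_4=e_4$, $e_3e_2=e_3$, $e_3e_4=e_1$, $e_4e_1=e_4$, $e_4e_3=e_2$ (all other products of basis elements are $0$) and $1=e_1+e_2$. As a topological vector space $\mathbb{H}(\mathbb{C})\cong\mathbb{C}^4$. Fix $a_1,a_2,b_1,b_2\in\mathbb{C}$ such that $i_1=1$, $i_2=a_1e_1+a_2e_2$, $i_3=b_1e_1+b_2e_2$ are linearly independent over $\mathbb{R}$. Let $E_3=\{\zeta=xi_1+yi_2+zi_3: x,y,z\in\mathbb{R}\}$.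 $\Omega$ is a domain in $\mathbb{R}^3$ and $\Omega_\zeta=\{xi_1+yi_2+zi_3:(x,y,z)\in\Omega\}\subset E_3$. A mapping $\Phi:\Omega_\zeta\to\mathbb{H}(\mathbb{C})$ is decomposed as $\Phi(\zeta)=\sum_{k=1}^4U_k(x,y,z)e_k$, $U_k:\Omega\to\mathbb{C}$. A component is $\mathbb{R}$-differentiable in $\Omega$ if it is (totally, Fréchet) differentiable as a function of the real variables $(x,y,z)$ at every point of $\Omega$. $G$-monogenic: a continuous mapping $\Phi:\Omega_\zeta\to\mathbb{H}(\mathbb{C})$ is right-$G$-monogenic in $\Omega_\zeta$ if for every $\zeta\in\Omega_\zeta$ there is $\Phi'(\zeta)\in\mathbb{H}(\mathbb{C})$ with $\lim_{\varepsilon\to0+0}(\Phi(\zeta+\varepsilon h)-\Phi(\zeta))\varepsilon^{-1}=h\,\Phi'(\zeta)$ for all $h\in E_3$. A continuous mapping $\widehat\Phi$ is left-$G$-monogenic in $\Omega_\zeta$ if for every $\zeta\in\Omega_\zeta$ there is $\widehat\Phi'(\zeta)\in\mathbb{H}(\mathbb{C})$ with $\lim_{\varepsilon\to0+0}(\widehat\Phi(\zeta+\varepsilon h)-\widehat\Phi(\zeta))\varepsilon^{-1}=\widehat\Phi'(\zeta)\,h$ for all $h\in E_3$. $H$-monogenic: a continuous mapping $\Phi=\sum_kU_ke_k$ is $H$-monogenic in $\Omega_\zeta$ if the $U_k$ have first-order partial derivatives in $x,y,z$ and the formal differential $d\Phi:=\sum_{k=1}^4\left(\frac{\partial U_k}{\partial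 x}dx+\frac{\partial U_k}{\partial y}dy+\frac{\partial U_k}{\partial z}dz\right)e_k$ can be written as $d\Phi=\sum_{s=1}^{16}A_s\,d\zeta\,B_s$ with some $\mathbb{H}(\mathbb{C})$-valued functions $A_s,B_s$ on $\Omega_\zeta$, where $d\zeta=dx+i_2dy+i_3dz$ (equality as linear forms in $dx,dy,dz$). Its Hausdorff derivative is $\Phi'_H(\zeta):=\sum_{s=1}^{16}A_sB_s$ (well defined, equal to $\frac{\partial\Phi}{\partial x}$). An $H$-monogenic mapping $\Phi$ is right-$H$-monogenic in $\Omega_\zeta$ if $d\Phi=d\zeta\,\Phi'_H(\zeta)$; an $H$-monogenic mapping $\widehat\Phi$ is left-$H$-monogenic in $\Omega_\zeta$ if $d\widehat\Phi=\widehat\Phi'_H(\zeta)\,d\zeta$. *)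

theory Defs
  imports "HOL-Analysis.Analysis"
begin

section \<open>The algebra of complex quaternions\<close>

text \<open>The fields of \<open>Biquat\<close> are the complex coordinates in the basis \<open>1, I, J, K\<close>.\<close>

datatype biquat = Biquat (c1: complex) (cI: complex) (cJ: complex) (cK: complex)

lemma biquat_eq_iff: "p = q \<longleftrightarrow> c1 p = c1 q \<and> cI p = cI q \<and> cJ p = cJ q \<and> cK p = cK q"
  by (metis biquat.expand)

instantiation biquat :: ring_1
begin

definition zero_biquat :: biquat where "0 = Biquat 0 0 0 0"
definition one_biquat :: biquat where "1 = Biquat 1 0 0 0"
definition plus_biquat :: "biquat \<Rightarrow> biquat \<Rightarrow> biquat" where
  "p + q = Biquat (c1 p + c1 q) (cI p + cI q) (cJ p + cJ q) (cK p + cK q)"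
definition uminus_biquat :: "biquat \<Rightarrow> biquat" where
  "- p = Biquat (- c1 p) (- cI p) (- cJ p) (- cK p)"
definition minus_biquat :: "biquat \<Rightarrow> biquat \<Rightarrow> biquat" where
  "p - q = Biquat (c1 p - c1 q) (cI p - cI q) (cJ p - cJ q) (cK p - cK q)"
definition times_biquat :: "biquat \<Rightarrow> biquat \<Rightarrow> biquat" where
  "p * q = Biquat
     (c1 p * c1 q - cI p * cI q - cJ p * cJ q - cK p * cK q)
     (c1 p * cI q + cI p * c1 q + cJ p * cK q - cK p * cJ q)
     (c1 p * cJ q - cI p * cK q + cJ p * c1 q + cK p * cI q)
     (c1 p * cK q + cI p * cJ q - cJ p * cI q + cK p * c1 q)"

instance
  by standard
    (simp_all add: biquat_eq_iff zero_biquat_def one_biquat_def plus_biquat_def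
      uminus_biquat_def minus_biquat_def times_biquat_def algebra_simps)

end

text \<open>The topology is that of \<open>\<complex>\<^sup>4\<close>, given by the Euclidean norm of the coordinates in the
  basis \<open>1, I, J, K\<close>.\<close>

instantiation biquat :: real_inner
begin

definition scaleR_biquat :: "real \<Rightarrow> biquat \<Rightarrow> biquat" where
  "r *\<^sub>R p = Biquat (r *\<^sub>R c1 p) (r *\<^sub>R cI p) (r *\<^sub>R cJ p) (r *\<^sub>R cK p)"
definition inner_biquat :: "biquat \<Rightarrow> biquat \<Rightarrow> real" where
  "p \<bullet> q = c1 p \<bullet> c1 q + cI p \<bullet> cI q + cJ p \<bullet> cJ q + cK p \<bullet> cK q"
definition norm_biquat :: "biquat \<Rightarrow> real" where
  "norm p = sqrt (p \<bullet> p)" for p :: biquat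
definition sgn_biquat :: "biquat \<Rightarrow> biquat" where
  "sgn p = inverse (norm p) *\<^sub>R p" for p :: biquat
definition dist_biquat :: "biquat \<Rightarrow> biquat \<Rightarrow> real" where
  "dist p q = norm (p - q)" for p q :: biquat
definition uniformity_biquat :: "(biquat \<times> biquat) filter" where
  "uniformity_biquat = (INF e\<in>{0 <..}. principal {(x, y). dist x y < e})"
definition open_biquat :: "biquat set \<Rightarrow> bool" where
  "open_biquat U \<longleftrightarrow> (\<forall>x\<in>U. \<forall>\<^sub>F (x', y) in uniformity. x' = x \<longrightarrow> y \<in> U)"

instance
proof
  fix p q s :: biquat and a b :: real
  show "a *\<^sub>R (p + q) = a *\<^sub>R p + a *\<^sub>R q" "(a + b) *\<^sub>R p = a *\<^sub>R p + b *\<^sub>R p"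
    "a *\<^sub>R b *\<^sub>R p = (a * b) *\<^sub>R p" "1 *\<^sub>R p = p"
    by (simp_all add: biquat_eq_iff scaleR_biquat_def plus_biquat_def algebra_simps)
  show "p \<bullet> q = q \<bullet> p" "(p + q) \<bullet> s = p \<bullet> s + q \<bullet> s" "(a *\<^sub>R p) \<bullet> q = a * (p \<bullet> q)"
    "0 \<le> p \<bullet> p"
    by (simp_all add: inner_biquat_def scaleR_biquat_def plus_biquat_def inner_commute
        inner_add_left algebra_simps)
  show "p \<bullet> p = 0 \<longleftrightarrow> p = 0"
    by (simp add: inner_biquat_def biquat_eq_iff zero_biquat_def add_nonneg_eq_0_iff)
qed (simp_all add: norm_biquat_def sgn_biquat_def dist_biquat_def uniformity_biquat_def
      open_biquat_def)

end

instance biquat :: real_algebra_1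
  by standard
    (simp_all add: biquat_eq_iff scaleR_biquat_def times_biquat_def one_biquat_def
      zero_biquat_def algebra_simps)

definition scaleC :: "complex \<Rightarrow> biquat \<Rightarrow> biquat" (infixr "*\<^sub>C" 75) where
  "c *\<^sub>C p = Biquat (c * c1 p) (c * cI p) (c * cJ p) (c * cK p)"

definition qI :: biquat where "qI = Biquat 0 1 0 0"
definition qJ :: biquat where "qJ = Biquat 0 0 1 0"
definition qK :: biquat where "qK = Biquat 0 0 0 1"

lemmas biquat_defs = biquat_eq_iff zero_biquat_def one_biquat_def plus_biquat_def
  uminus_biquat_def minus_biquat_def times_biquat_def scaleR_biquat_def scaleC_def
  qI_def qJ_def qK_def

lemma quaternion_relations:
  "qI * qI = -1" "qJ * qJ = -1" "qK * qK = -1"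
  "qI * qJ = qK" "qJ * qI = - qK" "qJ * qK = qI" "qK * qJ = - qI" "qK * qI = qJ" "qI * qK = - qJ"
  by (simp_all add: biquat_defs)

lemma scaleC_algebra:
  "(c *\<^sub>C p) * q = c *\<^sub>C (p * q)" "p * (c *\<^sub>C q) = c *\<^sub>C (p * q)" "of_real r *\<^sub>C p = r *\<^sub>R p"
  by (simp_all add: biquat_defs algebra_simps scaleR_conv_of_real)


section \<open>The basis \<open>e\<^sub>1, e\<^sub>2, e\<^sub>3, e\<^sub>4\<close>\<close>

definition e1 :: biquat where "e1 = (1/2) *\<^sub>C (1 + \<i> *\<^sub>C qI)"
definition e2 :: biquat where "e2 = (1/2) *\<^sub>C (1 - \<i> *\<^sub>C qI)"
definition e3 :: biquat where "e3 = (1/2) *\<^sub>C (\<i> *\<^sub>C qJ - qK)"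
definition e4 :: biquat where "e4 = (1/2) *\<^sub>C (\<i> *\<^sub>C qJ + qK)"

lemma e_products:
  "e1 * e1 = e1" "e1 * e2 = 0" "e1 * e3 = e3" "e1 * e4 = 0"
  "e2 * e1 = 0" "e2 * e2 = e2" "e2 * e3 = 0" "e2 * e4 = e4"
  "e3 * e1 = 0" "e3 * e2 = e3" "e3 * e3 = 0" "e3 * e4 = e1"
  "e4 * e1 = e4" "e4 * e2 = 0" "e4 * e3 = e2" "e4 * e4 = 0"
  "1 = e1 + e2"
  by (simp_all add: e1_def e2_def e3_def e4_def biquat_defs)

definition ebasis :: "nat \<Rightarrow> biquat" where
  "ebasis k = (if k = 1 then e1 else if k = 2 then e2 else if k = 3 then e3 else e4)"

text \<open>\<open>ecoord k q\<close> is the coefficient of \<open>q\<close> at \<open>ebasis k\<close> (for \<open>1 \<le> k \<le> 4\<close>); see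
  \<open>ecoord_unique\<close>.\<close>

definition ecoord :: "nat \<Rightarrow> biquat \<Rightarrow> complex" where
  "ecoord k q =
    (if k = 1 then c1 q - \<i> * cI q else if k = 2 then c1 q + \<i> * cI q
     else if k = 3 then - \<i> * cJ q - cK q else - \<i> * cJ q + cK q)"

lemma sum_1_4: "(\<Sum>k=1..4. f k) = f 1 + f 2 + f 3 + f (4::nat)" for f :: "nat \<Rightarrow> biquat"
proof -
  have "{1..4::nat} = {1, 2, 3, 4}" by auto
  then show ?thesis by (simp add: add.assoc)
qed

lemma ecoord_decomposition: "(\<Sum>k=1..4. ecoord k q *\<^sub>C ebasis k) = q"
  unfolding sum_1_4
  by (simp add: ebasis_def ecoord_def e1_def e2_def e3_def e4_def biquat_defs field_simps)

lemma ecoord_sum: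
  assumes "j \<in> {1..4}"
  shows "ecoord j (\<Sum>k=1..4. c k *\<^sub>C ebasis k) = c j"
proof -
  have "j = 1 \<or> j = 2 \<or> j = 3 \<or> j = 4" using assms by auto
  then show ?thesis
    unfolding sum_1_4
    by (elim disjE) (simp_all add: ebasis_def ecoord_def e1_def e2_def e3_def e4_def biquat_defs
        field_simps)
qed

lemma ecoord_unique:
  "q = (\<Sum>k=1..4. c k *\<^sub>C ebasis k) \<longleftrightarrow> (\<forall>k\<in>{1..4}. c k = ecoord k q)"
proof
  assume "q = (\<Sum>k=1..4. c k *\<^sub>C ebasis k)"
  then show "\<forall>k\<in>{1..4}. c k = ecoord k q"
    using ecoord_sum by simp
next
  assume "\<forall>k\<in>{1..4}. c k = ecoord k q"
  then have "(\<Sum>k=1..4. c k *\<^sub>C ebasis k) = (\<Sum>k=1..4. ecoord k q *\<^sub>C ebasis k)"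
    by (intro sum.cong) auto
  then show "q = (\<Sum>k=1..4. c k *\<^sub>C ebasis k)"
    unfolding ecoord_decomposition by (rule sym)
qed


section \<open>The subspace \<open>E\<^sub>3\<close>, components and the formal differential\<close>

text \<open>\<open>zeta i2 i3 (x, y, z) = x + y i\<^sub>2 + z i\<^sub>3\<close>. Applied to increments \<open>(dx, dy, dz)\<close> the same
  map is the linear form \<open>d\<zeta>\<close>.\<close>

definition zeta :: "biquat \<Rightarrow> biquat \<Rightarrow> real^3 \<Rightarrow> biquat" where
  "zeta i2 i3 p = p$1 *\<^sub>R 1 + p$2 *\<^sub>R i2 + p$3 *\<^sub>R i3"

definition E3 :: "biquat \<Rightarrow> biquat \<Rightarrow> biquat set" where
  "E3 i2 i3 = range (zeta i2 i3)"

definition Omega_zeta :: "biquat \<Rightarrow> biquat \<Rightarrow> (real^3) set \<Rightarrow> biquat set" where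
  "Omega_zeta i2 i3 \<Omega> = zeta i2 i3 ` \<Omega>"

definition lin_indep3 :: "biquat \<Rightarrow> biquat \<Rightarrow> bool" where
  "lin_indep3 i2 i3 \<longleftrightarrow> distinct [1, i2, i3] \<and> independent {1, i2, i3}"

definition is_domain :: "(real^3) set \<Rightarrow> bool" where
  "is_domain \<Omega> \<longleftrightarrow> open \<Omega> \<and> connected \<Omega> \<and> \<Omega> \<noteq> {}"

text \<open>The component \<open>U\<^sub>k(x, y, z)\<close> of \<open>\<Phi>\<close>; its values outside \<open>\<Omega>\<close> are irrelevant because \<open>\<Omega>\<close> is
  open.\<close>

definition component :: "biquat \<Rightarrow> biquat \<Rightarrow> (biquat \<Rightarrow> biquat) \<Rightarrow> nat \<Rightarrow> real^3 \<Rightarrow> complex" where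
  "component i2 i3 \<Phi> k p = ecoord k (\<Phi> (zeta i2 i3 p))"

definition R_differentiable_components ::
  "biquat \<Rightarrow> biquat \<Rightarrow> (real^3) set \<Rightarrow> (biquat \<Rightarrow> biquat) \<Rightarrow> bool" where
  "R_differentiable_components i2 i3 \<Omega> \<Phi> \<longleftrightarrow>
     (\<forall>k\<in>{1..4}. \<forall>p\<in>\<Omega>. component i2 i3 \<Phi> k differentiable (at p))"

definition has_partial :: "3 \<Rightarrow> (real^3 \<Rightarrow> complex) \<Rightarrow> real^3 \<Rightarrow> bool" where
  "has_partial j U p \<longleftrightarrow> (\<lambda>t::real. U (p + t *\<^sub>R axis j 1)) differentiable (at 0)"

definition partial :: "3 \<Rightarrow> (real^3 \<Rightarrow> complex) \<Rightarrow> real^3 \<Rightarrow> complex" where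
  "partial j U p = vector_derivative (\<lambda>t::real. U (p + t *\<^sub>R axis j 1)) (at 0)"

text \<open>\<open>formal_diff i2 i3 \<Phi> p v\<close> is the linear form \<open>d\<Phi>\<close> at the point \<open>p\<close>, evaluated at
  \<open>v = (dx, dy, dz)\<close>.\<close>

definition formal_diff ::
  "biquat \<Rightarrow> biquat \<Rightarrow> (biquat \<Rightarrow> biquat) \<Rightarrow> real^3 \<Rightarrow> real^3 \<Rightarrow> biquat" where
  "formal_diff i2 i3 \<Phi> p v =
     (\<Sum>k=1..4. (partial 1 (component i2 i3 \<Phi> k) p * of_real (v$1)
              + partial 2 (component i2 i3 \<Phi> k) p * of_real (v$2)
              + partial 3 (component i2 i3 \<Phi> k) p * of_real (v$3)) *\<^sub>C ebasis k)"


section \<open>\<open>G\<close>-monogenic mappings\<close>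

definition right_G_monogenic ::
  "biquat \<Rightarrow> biquat \<Rightarrow> (real^3) set \<Rightarrow> (biquat \<Rightarrow> biquat) \<Rightarrow> bool" where
  "right_G_monogenic i2 i3 \<Omega> \<Phi> \<longleftrightarrow>
     continuous_on (Omega_zeta i2 i3 \<Omega>) \<Phi> \<and>
     (\<forall>\<zeta>\<in>Omega_zeta i2 i3 \<Omega>. \<exists>D. \<forall>h\<in>E3 i2 i3.
        ((\<lambda>\<epsilon>::real. inverse \<epsilon> *\<^sub>R (\<Phi> (\<zeta> + \<epsilon> *\<^sub>R h) - \<Phi> \<zeta>)) \<longlongrightarrow> h * D) (at_right 0))"

definition left_G_monogenic ::
  "biquat \<Rightarrow> biquat \<Rightarrow> (real^3) set \<Rightarrow> (biquat \<Rightarrow> biquat) \<Rightarrow> bool" where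
  "left_G_monogenic i2 i3 \<Omega> \<Phi> \<longleftrightarrow>
     continuous_on (Omega_zeta i2 i3 \<Omega>) \<Phi> \<and>
     (\<forall>\<zeta>\<in>Omega_zeta i2 i3 \<Omega>. \<exists>D. \<forall>h\<in>E3 i2 i3.
        ((\<lambda>\<epsilon>::real. inverse \<epsilon> *\<^sub>R (\<Phi> (\<zeta> + \<epsilon> *\<^sub>R h) - \<Phi> \<zeta>)) \<longlongrightarrow> D * h) (at_right 0))"


section \<open>\<open>H\<close>-monogenic mappings\<close>

definition hausdorff_rep ::
  "biquat \<Rightarrow> biquat \<Rightarrow> (real^3) set \<Rightarrow> (biquat \<Rightarrow> biquat) \<Rightarrow>
   (nat \<Rightarrow> biquat \<Rightarrow> biquat) \<Rightarrow> (nat \<Rightarrow> biquat \<Rightarrow> biquat) \<Rightarrow> bool" where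
  "hausdorff_rep i2 i3 \<Omega> \<Phi> A B \<longleftrightarrow>
     (\<forall>p\<in>\<Omega>. \<forall>v. formal_diff i2 i3 \<Phi> p v =
        (\<Sum>s=1..16. A s (zeta i2 i3 p) * zeta i2 i3 v * B s (zeta i2 i3 p)))"

definition H_monogenic ::
  "biquat \<Rightarrow> biquat \<Rightarrow> (real^3) set \<Rightarrow> (biquat \<Rightarrow> biquat) \<Rightarrow> bool" where
  "H_monogenic i2 i3 \<Omega> \<Phi> \<longleftrightarrow>
     continuous_on (Omega_zeta i2 i3 \<Omega>) \<Phi> \<and>
     (\<forall>k\<in>{1..4}. \<forall>p\<in>\<Omega>. \<forall>j. has_partial j (component i2 i3 \<Phi> k) p) \<and>
     (\<exists>A B. hausdorff_rep i2 i3 \<Omega> \<Phi> A B)"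

definition hausdorff_deriv ::
  "biquat \<Rightarrow> biquat \<Rightarrow> (real^3) set \<Rightarrow> (biquat \<Rightarrow> biquat) \<Rightarrow> biquat \<Rightarrow> biquat" where
  "hausdorff_deriv i2 i3 \<Omega> \<Phi> \<zeta> =
     (THE D. \<exists>A B. hausdorff_rep i2 i3 \<Omega> \<Phi> A B \<and> D = (\<Sum>s=1..16. A s \<zeta> * B s \<zeta>))"

lemma hausdorff_rep_sum:
  assumes "hausdorff_rep i2 i3 \<Omega> \<Phi> A B" "p \<in> \<Omega>"
  shows "(\<Sum>s=1..16. A s (zeta i2 i3 p) * B s (zeta i2 i3 p)) = formal_diff i2 i3 \<Phi> p (axis 1 1)"
proof -
  have "zeta i2 i3 (axis 1 1) = 1"
    by (simp add: zeta_def axis_def)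
  then show ?thesis
    using assms by (simp add: hausdorff_rep_def)
qed

text \<open>The Hausdorff derivative does not depend on the choice of the representation.\<close>

lemma hausdorff_deriv_eq:
  assumes "hausdorff_rep i2 i3 \<Omega> \<Phi> A B" "\<zeta> \<in> Omega_zeta i2 i3 \<Omega>"
  shows "hausdorff_deriv i2 i3 \<Omega> \<Phi> \<zeta> = (\<Sum>s=1..16. A s \<zeta> * B s \<zeta>)"
proof -
  obtain p where p: "p \<in> \<Omega>" "\<zeta> = zeta i2 i3 p"
    using assms(2) by (auto simp: Omega_zeta_def)
  show ?thesis
    unfolding hausdorff_deriv_def
  proof (rule the_equality)
    show "\<exists>A' B'. hausdorff_rep i2 i3 \<Omega> \<Phi> A' B' \<and>
        (\<Sum>s=1..16. A s \<zeta> * B s \<zeta>) = (\<Sum>s=1..16. A' s \<zeta> * B' s \<zeta>)"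
      using assms(1) by blast
  next
    fix D
    assume "\<exists>A' B'. hausdorff_rep i2 i3 \<Omega> \<Phi> A' B' \<and> D = (\<Sum>s=1..16. A' s \<zeta> * B' s \<zeta>)"
    then show "D = (\<Sum>s=1..16. A s \<zeta> * B s \<zeta>)"
      using hausdorff_rep_sum[OF _ p(1)] assms(1) unfolding p(2) by metis
  qed
qed

definition right_H_monogenic ::
  "biquat \<Rightarrow> biquat \<Rightarrow> (real^3) set \<Rightarrow> (biquat \<Rightarrow> biquat) \<Rightarrow> bool" where
  "right_H_monogenic i2 i3 \<Omega> \<Phi> \<longleftrightarrow>
     H_monogenic i2 i3 \<Omega> \<Phi> \<and>
     (\<forall>p\<in>\<Omega>. \<forall>v. formal_diff i2 i3 \<Phi> p v =
        zeta i2 i3 v * hausdorff_deriv i2 i3 \<Omega> \<Phi> (zeta i2 i3 p))"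

definition left_H_monogenic ::
  "biquat \<Rightarrow> biquat \<Rightarrow> (real^3) set \<Rightarrow> (biquat \<Rightarrow> biquat) \<Rightarrow> bool" where
  "left_H_monogenic i2 i3 \<Omega> \<Phi> \<longleftrightarrow>
     H_monogenic i2 i3 \<Omega> \<Phi> \<and>
     (\<forall>p\<in>\<Omega>. \<forall>v. formal_diff i2 i3 \<Phi> p v =
        hausdorff_deriv i2 i3 \<Omega> \<Phi> (zeta i2 i3 p) * zeta i2 i3 v)"

end

theory Submission
  imports Defs
begin

text \<open>
  Both notions say the same thing about the differential of the mapping at each point. Since
  \<open>\<zeta> + \<epsilon>h\<close> with \<open>h = zeta i2 i3 v\<close> is the image of \<open>p + \<epsilon>v\<close>, the limit in the definition of
  \<open>G\<close>-monogeneity is a directional derivative of the components in the direction \<open>v\<close>. Total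
  differentiability makes it linear in \<open>v\<close>, and so it equals the formal differential \<open>d\<Phi>(v)\<close>
  built from the partial derivatives (\<open>difference_quotient_tendsto\<close>). By uniqueness of limits,
  right-\<open>G\<close>-monogeneity is then the existence, for each \<open>\<zeta>\<close>, of some \<open>D\<close> with
  \<open>d\<Phi>(v) = zeta i2 i3 v * D\<close> for all \<open>v\<close>.

  Such a \<open>D\<close> is a Hausdorff representation with a single nonzero term, \<open>d\<Phi> = 1 d\<zeta> D\<close>, whose
  Hausdorff derivative is \<open>D\<close> itself (\<open>hausdorff_rep_single_term\<close>); conversely the Hausdorff
  derivative of a right-\<open>H\<close>-monogenic mapping serves as \<open>D\<close>. The left case uses \<open>d\<Phi> = D d\<zeta> 1\<close>.
\<close>

section \<open>The formal differential as a directional derivative\<close>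

lemma zeta_line: "zeta i2 i3 (p + t *\<^sub>R v) = zeta i2 i3 p + t *\<^sub>R zeta i2 i3 v"
  by (simp add: zeta_def scaleR_add_left scaleR_add_right)

lemma has_derivative_along_line:
  fixes U :: "'a::real_normed_vector \<Rightarrow> 'b::real_normed_vector"
  assumes "(U has_derivative F) (at p)"
  shows "((\<lambda>t. U (p + t *\<^sub>R v)) has_vector_derivative F v) (at 0)"
proof -
  have line: "((\<lambda>t. p + t *\<^sub>R v) has_derivative (\<lambda>t. t *\<^sub>R v)) (at 0)"
    by (auto intro!: derivative_eq_intros)
  have "(U has_derivative F) (at (p + 0 *\<^sub>R v))"
    using assms by simp
  from has_derivative_compose[OF line this]
  show ?thesis
    using linear_cmul[OF has_derivative_linear[OF assms]]
    by (simp add: has_vector_derivative_def)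
qed

lemma right_difference_quotient_tendsto:
  fixes g :: "real \<Rightarrow> 'b::real_normed_vector"
  assumes "(g has_vector_derivative d) (at 0)"
  shows "((\<lambda>\<epsilon>. inverse \<epsilon> *\<^sub>R (g \<epsilon> - g 0)) \<longlongrightarrow> d) (at_right 0)"
proof -
  have "(g has_derivative (\<lambda>t. t *\<^sub>R d)) (at_right 0)"
    using has_vector_derivative_at_within[OF assms] by (simp add: has_vector_derivative_def)
  then have "((\<lambda>\<epsilon>. (g \<epsilon> - g 0 - \<epsilon> *\<^sub>R d) /\<^sub>R \<bar>\<epsilon>\<bar>) \<longlongrightarrow> 0) (at_right 0)"
    by (simp add: has_derivative_at_within)
  moreover have "\<forall>\<^sub>F \<epsilon> in at_right 0.
      (g \<epsilon> - g 0 - \<epsilon> *\<^sub>R d) /\<^sub>R \<bar>\<epsilon>\<bar> = inverse \<epsilon> *\<^sub>R (g \<epsilon> - g 0) - d"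
    by (auto simp: eventually_at_filter scaleR_diff_right)
  ultimately have "((\<lambda>\<epsilon>. inverse \<epsilon> *\<^sub>R (g \<epsilon> - g 0) - d) \<longlongrightarrow> 0) (at_right 0)"
    by (rule Lim_transform_eventually)
  then show ?thesis
    by (simp only: LIM_zero_iff)
qed

lemma has_partial_if_differentiable:
  assumes "U differentiable (at p)"
  shows "has_partial j U p"
  using assms has_derivative_along_line
  unfolding has_partial_def differentiable_def has_vector_derivative_def by blast

lemma partial_eq_derivative:
  assumes "(U has_derivative F) (at p)"
  shows "partial j U p = F (axis j 1)"
  unfolding partial_def
  by (rule vector_derivative_at[OF has_derivative_along_line[OF assms]])

lemma derivative_eq_partials:
  assumes "(U has_derivative F) (at p)"
  shows "F v = partial 1 U p * of_real (v$1) + partial 2 U p * of_real (v$2)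
             + partial 3 U p * of_real (v$3)"
proof -
  have lin: "linear F"
    using assms by (rule has_derivative_linear)
  have "v = v$1 *\<^sub>R axis 1 1 + v$2 *\<^sub>R axis 2 1 + v$3 *\<^sub>R axis 3 1"
    by (simp add: vec_eq_iff forall_3 axis_def)
  then have "F v = F (v$1 *\<^sub>R axis 1 1 + v$2 *\<^sub>R axis 2 1 + v$3 *\<^sub>R axis 3 1)"
    by simp
  also have "\<dots> = v$1 *\<^sub>R F (axis 1 1) + v$2 *\<^sub>R F (axis 2 1) + v$3 *\<^sub>R F (axis 3 1)"
    by (simp add: linear_add[OF lin] linear_cmul[OF lin])
  finally show ?thesis
    by (simp add: partial_eq_derivative[OF assms] scaleR_conv_of_real mult.commute)
qed

text \<open>The real vector space structure suffices, because multiplication by \<open>w\<close> is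
  \<open>Re w + Im w \<i>\<close> with \<open>\<i>\<close> absorbed into the fixed factor \<open>q\<close>.\<close>

lemma tendsto_scaleC:
  assumes "(f \<longlongrightarrow> c) net"
  shows "((\<lambda>x. f x *\<^sub>C q) \<longlongrightarrow> c *\<^sub>C q) net"
proof -
  have "((\<lambda>x. Re (f x) *\<^sub>R q + Im (f x) *\<^sub>R (\<i> *\<^sub>C q)) \<longlongrightarrow>
      Re c *\<^sub>R q + Im c *\<^sub>R (\<i> *\<^sub>C q)) net"
    by (intro tendsto_intros assms)
  moreover have "Re w *\<^sub>R q + Im w *\<^sub>R (\<i> *\<^sub>C q) = w *\<^sub>C q" for w
    by (simp add: biquat_defs complex_eq_iff)
  ultimately show ?thesis
    by (simp only:)
qed

lemma ecoord_scaleR_diff: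
  "ecoord k (r *\<^sub>R (p - q)) = r *\<^sub>R (ecoord k p - ecoord k q)"
  by (simp add: ecoord_def biquat_defs scaleR_conv_of_real algebra_simps)

text \<open>The mere existence of partial derivatives would not determine the limit in a direction \<open>v\<close>
  off the axes; a total derivative of each component is linear in \<open>v\<close>, so there the partial
  derivatives do.\<close>

lemma difference_quotient_tendsto:
  assumes diff: "\<And>k. k \<in> {1..4} \<Longrightarrow> component i2 i3 \<Phi> k differentiable (at p)"
  shows "((\<lambda>\<epsilon>::real. inverse \<epsilon> *\<^sub>R
            (\<Phi> (zeta i2 i3 p + \<epsilon> *\<^sub>R zeta i2 i3 v) - \<Phi> (zeta i2 i3 p)))
          \<longlongrightarrow> formal_diff i2 i3 \<Phi> p v) (at_right 0)"
    (is "(?Q \<longlongrightarrow> _) _")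
proof -
  have "((\<lambda>\<epsilon>. ecoord k (?Q \<epsilon>)) \<longlongrightarrow>
          partial 1 (component i2 i3 \<Phi> k) p * of_real (v$1)
        + partial 2 (component i2 i3 \<Phi> k) p * of_real (v$2)
        + partial 3 (component i2 i3 \<Phi> k) p * of_real (v$3)) (at_right 0)"
    if k: "k \<in> {1..4}" for k
  proof -
    let ?U = "component i2 i3 \<Phi> k"
    obtain F where F: "(?U has_derivative F) (at p)"
      using diff[OF k] by (auto simp: differentiable_def)
    have "((\<lambda>\<epsilon>. inverse \<epsilon> *\<^sub>R (?U (p + \<epsilon> *\<^sub>R v) - ?U p)) \<longlongrightarrow> F v) (at_right 0)"
      using right_difference_quotient_tendsto[OF has_derivative_along_line[OF F]] by simp
    then show ?thesis
      by (simp add: derivative_eq_partials[OF F] ecoord_scaleR_diff component_def zeta_line)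
  qed
  then have "((\<lambda>\<epsilon>. \<Sum>k=1..4. ecoord k (?Q \<epsilon>) *\<^sub>C ebasis k) \<longlongrightarrow> formal_diff i2 i3 \<Phi> p v)
      (at_right 0)"
    unfolding formal_diff_def by (intro tendsto_sum tendsto_scaleC)
  then show ?thesis
    unfolding ecoord_decomposition .
qed

lemma difference_quotient_tendsto_iff:
  assumes "\<And>k. k \<in> {1..4} \<Longrightarrow> component i2 i3 \<Phi> k differentiable (at p)"
  shows "((\<lambda>\<epsilon>::real. inverse \<epsilon> *\<^sub>R
            (\<Phi> (zeta i2 i3 p + \<epsilon> *\<^sub>R zeta i2 i3 v) - \<Phi> (zeta i2 i3 p))) \<longlongrightarrow> L) (at_right 0)
         \<longleftrightarrow> formal_diff i2 i3 \<Phi> p v = L"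
  using difference_quotient_tendsto[OF assms] tendsto_unique[OF trivial_limit_at_right_real]
  by blast

lemma ball_E3: "(\<forall>h\<in>E3 i2 i3. P h) \<longleftrightarrow> (\<forall>v. P (zeta i2 i3 v))"
  by (auto simp: E3_def)

text \<open>The derivative chosen at each \<open>\<zeta>\<close> is collected into a function \<open>D\<close> of \<open>\<zeta>\<close>, since the
  coefficients of a Hausdorff representation are functions on \<open>\<Omega>\<^sub>\<zeta>\<close>.\<close>

lemma right_G_monogenic_iff:
  assumes "R_differentiable_components i2 i3 \<Omega> \<Phi>"
  shows "right_G_monogenic i2 i3 \<Omega> \<Phi> \<longleftrightarrow> continuous_on (Omega_zeta i2 i3 \<Omega>) \<Phi> \<and>
    (\<exists>D. \<forall>p\<in>\<Omega>. \<forall>v. formal_diff i2 i3 \<Phi> p v = zeta i2 i3 v * D (zeta i2 i3 p))"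
proof -
  let ?lim = "\<lambda>\<zeta> D. \<forall>h\<in>E3 i2 i3.
    ((\<lambda>\<epsilon>::real. inverse \<epsilon> *\<^sub>R (\<Phi> (\<zeta> + \<epsilon> *\<^sub>R h) - \<Phi> \<zeta>)) \<longlongrightarrow> h * D) (at_right 0)"
  have pt: "?lim (zeta i2 i3 p) D \<longleftrightarrow> (\<forall>v. formal_diff i2 i3 \<Phi> p v = zeta i2 i3 v * D)"
    if "p \<in> \<Omega>" for p D
  proof -
    have "component i2 i3 \<Phi> k differentiable (at p)" if "k \<in> {1..4}" for k
      using assms that \<open>p \<in> \<Omega>\<close> unfolding R_differentiable_components_def by blast
    then show ?thesis
      unfolding ball_E3 by (subst difference_quotient_tendsto_iff) auto
  qed
  have "(\<forall>\<zeta>\<in>Omega_zeta i2 i3 \<Omega>. \<exists>D. ?lim \<zeta> D) \<longleftrightarrow>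
      (\<exists>D. \<forall>p\<in>\<Omega>. ?lim (zeta i2 i3 p) (D (zeta i2 i3 p)))"
    unfolding bchoice_iff by (simp add: Omega_zeta_def)
  then show ?thesis
    unfolding right_G_monogenic_def by (simp add: pt)
qed

lemma left_G_monogenic_iff:
  assumes "R_differentiable_components i2 i3 \<Omega> \<Phi>"
  shows "left_G_monogenic i2 i3 \<Omega> \<Phi> \<longleftrightarrow> continuous_on (Omega_zeta i2 i3 \<Omega>) \<Phi> \<and>
    (\<exists>D. \<forall>p\<in>\<Omega>. \<forall>v. formal_diff i2 i3 \<Phi> p v = D (zeta i2 i3 p) * zeta i2 i3 v)"
proof -
  let ?lim = "\<lambda>\<zeta> D. \<forall>h\<in>E3 i2 i3.
    ((\<lambda>\<epsilon>::real. inverse \<epsilon> *\<^sub>R (\<Phi> (\<zeta> + \<epsilon> *\<^sub>R h) - \<Phi> \<zeta>)) \<longlongrightarrow> D * h) (at_right 0)"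
  have pt: "?lim (zeta i2 i3 p) D \<longleftrightarrow> (\<forall>v. formal_diff i2 i3 \<Phi> p v = D * zeta i2 i3 v)"
    if "p \<in> \<Omega>" for p D
  proof -
    have "component i2 i3 \<Phi> k differentiable (at p)" if "k \<in> {1..4}" for k
      using assms that \<open>p \<in> \<Omega>\<close> unfolding R_differentiable_components_def by blast
    then show ?thesis
      unfolding ball_E3 by (subst difference_quotient_tendsto_iff) auto
  qed
  have "(\<forall>\<zeta>\<in>Omega_zeta i2 i3 \<Omega>. \<exists>D. ?lim \<zeta> D) \<longleftrightarrow>
      (\<exists>D. \<forall>p\<in>\<Omega>. ?lim (zeta i2 i3 p) (D (zeta i2 i3 p)))"
    unfolding bchoice_iff by (simp add: Omega_zeta_def)
  then show ?thesis
    unfolding left_G_monogenic_def by (simp add: pt)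
qed

section \<open>One-term Hausdorff representations\<close>

lemma hausdorff_rep_single_term:
  assumes "\<And>p v. p \<in> \<Omega> \<Longrightarrow>
    formal_diff i2 i3 \<Phi> p v = A (zeta i2 i3 p) * zeta i2 i3 v * B (zeta i2 i3 p)"
  shows "\<exists>A' B'. hausdorff_rep i2 i3 \<Omega> \<Phi> A' B'"
    and "p \<in> \<Omega> \<Longrightarrow> hausdorff_deriv i2 i3 \<Omega> \<Phi> (zeta i2 i3 p) = A (zeta i2 i3 p) * B (zeta i2 i3 p)"
proof -
  define A' where "A' = (\<lambda>(s::nat) \<zeta>. if s = 1 then A \<zeta> else 0)"
  have sum: "(\<Sum>s=1..16. A' s \<zeta> * q * B \<zeta>) = A \<zeta> * q * B \<zeta>" for \<zeta> q
    by (subst sum.mono_neutral_right[of _ "{1}"]) (auto simp: A'_def)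
  have rep: "hausdorff_rep i2 i3 \<Omega> \<Phi> A' (\<lambda>s. B)"
    unfolding hausdorff_rep_def sum using assms by blast
  then show "\<exists>A' B'. hausdorff_rep i2 i3 \<Omega> \<Phi> A' B'"
    by blast
  show "hausdorff_deriv i2 i3 \<Omega> \<Phi> (zeta i2 i3 p) = A (zeta i2 i3 p) * B (zeta i2 i3 p)"
    if "p \<in> \<Omega>"
    using hausdorff_deriv_eq[OF rep, of "zeta i2 i3 p"] that sum[of "zeta i2 i3 p" 1]
    by (simp add: Omega_zeta_def)
qed

lemma R_differentiable_imp_has_partial:
  assumes "R_differentiable_components i2 i3 \<Omega> \<Phi>" "k \<in> {1..4}" "p \<in> \<Omega>"
  shows "has_partial j (component i2 i3 \<Phi> k) p"
  using assms has_partial_if_differentiable unfolding R_differentiable_components_def by blast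

lemma right_H_monogenic_iff:
  assumes "R_differentiable_components i2 i3 \<Omega> \<Phi>"
  shows "right_H_monogenic i2 i3 \<Omega> \<Phi> \<longleftrightarrow> continuous_on (Omega_zeta i2 i3 \<Omega>) \<Phi> \<and>
    (\<exists>D. \<forall>p\<in>\<Omega>. \<forall>v. formal_diff i2 i3 \<Phi> p v = zeta i2 i3 v * D (zeta i2 i3 p))"
    (is "_ \<longleftrightarrow> ?cont \<and> ?factor")
proof
  assume "right_H_monogenic i2 i3 \<Omega> \<Phi>"
  then show "?cont \<and> ?factor"
    unfolding right_H_monogenic_def H_monogenic_def by blast
next
  assume r: "?cont \<and> ?factor"
  then obtain D where
    D: "\<And>p v. p \<in> \<Omega> \<Longrightarrow> formal_diff i2 i3 \<Phi> p v = zeta i2 i3 v * D (zeta i2 i3 p)"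
    by blast
  note single = hausdorff_rep_single_term[of \<Omega> i2 i3 \<Phi> "\<lambda>_. 1" D, simplified, OF D]
  show "right_H_monogenic i2 i3 \<Omega> \<Phi>"
    using r single R_differentiable_imp_has_partial[OF assms]
    by (simp add: right_H_monogenic_def H_monogenic_def D)
qed

lemma left_H_monogenic_iff:
  assumes "R_differentiable_components i2 i3 \<Omega> \<Phi>"
  shows "left_H_monogenic i2 i3 \<Omega> \<Phi> \<longleftrightarrow> continuous_on (Omega_zeta i2 i3 \<Omega>) \<Phi> \<and>
    (\<exists>D. \<forall>p\<in>\<Omega>. \<forall>v. formal_diff i2 i3 \<Phi> p v = D (zeta i2 i3 p) * zeta i2 i3 v)"
    (is "_ \<longleftrightarrow> ?cont \<and> ?factor")
proof
  assume "left_H_monogenic i2 i3 \<Omega> \<Phi>"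
  then show "?cont \<and> ?factor"
    unfolding left_H_monogenic_def H_monogenic_def by blast
next
  assume r: "?cont \<and> ?factor"
  then obtain D where
    D: "\<And>p v. p \<in> \<Omega> \<Longrightarrow> formal_diff i2 i3 \<Phi> p v = D (zeta i2 i3 p) * zeta i2 i3 v"
    by blast
  note single = hausdorff_rep_single_term[of \<Omega> i2 i3 \<Phi> D "\<lambda>_. 1", simplified, OF D]
  show "left_H_monogenic i2 i3 \<Omega> \<Phi>"
    using r single R_differentiable_imp_has_partial[OF assms]
    by (simp add: left_H_monogenic_def H_monogenic_def D)
qed

theorem mainTheorem2:
  fixes a1 a2 b1 b2 :: complex
    and i2 i3 :: biquat
    and \<Omega> :: "(real^3) set"
    and \<Phi> \<Phi>hat :: "biquat \<Rightarrow> biquat"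
  assumes "i2 = a1 *\<^sub>C e1 + a2 *\<^sub>C e2"
    and "i3 = b1 *\<^sub>C e1 + b2 *\<^sub>C e2"
    and "lin_indep3 i2 i3"
    and "is_domain \<Omega>"
    and "R_differentiable_components i2 i3 \<Omega> \<Phi>"
    and "R_differentiable_components i2 i3 \<Omega> \<Phi>hat"
  shows "(right_G_monogenic i2 i3 \<Omega> \<Phi> \<longleftrightarrow> right_H_monogenic i2 i3 \<Omega> \<Phi>) \<and>
         (left_G_monogenic i2 i3 \<Omega> \<Phi>hat \<longleftrightarrow> left_H_monogenic i2 i3 \<Omega> \<Phi>hat)"
  using right_G_monogenic_iff[OF assms(5)] right_H_monogenic_iff[OF assms(5)]
    left_G_monogenic_iff[OF assms(6)] left_H_monogenic_iff[OF assms(6)]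
  by simp

end
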